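(* Every $T_{0}$ strongly topological gyrogroup is completely regular.
   Context: A gyrogroup is a nonempty set $G$ with a binary operation $\oplus$ such that: (G1) there is a unique identity element $0\in G$ with $0\oplus a=a=a\oplus 0$ for all $a\in G$; (G2) for each $x\in G$ there is a unique inverse $\ominus x\in G$ with $\ominus x\oplus x=0=x\oplus(\ominus x)$; (G3) for all $x,y\in G$ there is a bijective homomorphism $\mathrm{gyr}[x,y]$ of $(G,\oplus)$ onto itself such that $x\oplus(y\oplus z)=(x\oplus y)\oplus \mathrm{gyr}[x,y](z)$ for all $z\in G$; (G4) $\mathrm{gyr}[x\oplus y,y]=\mathrm{gyr}[x,y]$ for all $x,y\in G$. A topological gyrogroup is a gyrogroup $(G,\oplus)$ with a topology such that $\oplus:G\times G\to G$ is (jointly) continuous and $x\mapsto\ominus x$ is continuous. A strongly topological gyrogroup is a topological gyrogroup $G$ for which there exists a neighborhood base $\mathscr U$ of $0$ such that $\mathrm{gyr}[x,y](U)=U$ for every $U\in\mathscr U$ and all $x,y\in G$. A space is completely regular if it is $T_1$ and for every closed set $F$ and every point $x\notin F$ there is a continuous function $f$ from the space to $[0,1]$ with $f(x)=0$ and $f=1$ on $F$. *)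

theory Defs
  imports "HOL-Analysis.Analysis"
begin

text \<open>
  Algebraic structures are carrier-based, so that the underlying space can be an arbitrary
  \<open>'a topology\<close> whose \<open>topspace\<close> is the carrier. The identity, the inverse operation and the
  gyrations are uniquely determined on \<open>G\<close> by \<open>\<oplus>\<close>; making them parameters only names them.
  Nothing is assumed about the operations outside \<open>G\<close>.
\<close>

locale gyrogroup =
  fixes G :: "'a set"
    and add :: "'a \<Rightarrow> 'a \<Rightarrow> 'a" (infixl "\<oplus>" 65)
    and gzero :: 'a ("\<zero>")
    and neg :: "'a \<Rightarrow> 'a" ("\<ominus> _" [81] 80)
    and gyr :: "'a \<Rightarrow> 'a \<Rightarrow> 'a \<Rightarrow> 'a"
  assumes add_closed: "\<lbrakk>x \<in> G; y \<in> G\<rbrakk> \<Longrightarrow> x \<oplus> y \<in> G"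
    and zero_closed: "\<zero> \<in> G"
    and zero_add: "a \<in> G \<Longrightarrow> \<zero> \<oplus> a = a"
    and add_zero: "a \<in> G \<Longrightarrow> a \<oplus> \<zero> = a"
    and zero_unique: "\<lbrakk>e \<in> G; \<And>a. a \<in> G \<Longrightarrow> e \<oplus> a = a \<and> a \<oplus> e = a\<rbrakk> \<Longrightarrow> e = \<zero>"
    and neg_closed: "x \<in> G \<Longrightarrow> \<ominus> x \<in> G"
    and neg_add: "x \<in> G \<Longrightarrow> \<ominus> x \<oplus> x = \<zero>"
    and add_neg: "x \<in> G \<Longrightarrow> x \<oplus> (\<ominus> x) = \<zero>"
    and neg_unique: "\<lbrakk>x \<in> G; y \<in> G; y \<oplus> x = \<zero>; x \<oplus> y = \<zero>\<rbrakk> \<Longrightarrow> y = \<ominus> x"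
    and gyr_bij: "\<lbrakk>x \<in> G; y \<in> G\<rbrakk> \<Longrightarrow> bij_betw (gyr x y) G G"
    and gyr_hom: "\<lbrakk>x \<in> G; y \<in> G; a \<in> G; b \<in> G\<rbrakk>
          \<Longrightarrow> gyr x y (a \<oplus> b) = gyr x y a \<oplus> gyr x y b"
    and gyr_assoc: "\<lbrakk>x \<in> G; y \<in> G; z \<in> G\<rbrakk>
          \<Longrightarrow> x \<oplus> (y \<oplus> z) = (x \<oplus> y) \<oplus> gyr x y z"
    and gyr_loop: "\<lbrakk>x \<in> G; y \<in> G; z \<in> G\<rbrakk> \<Longrightarrow> gyr (x \<oplus> y) y z = gyr x y z"

locale topological_gyrogroup = gyrogroup +
  fixes T :: "'a topology"
  assumes topspace_eq: "topspace T = G"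
    and continuous_add: "continuous_map (prod_topology T T) T (\<lambda>(x, y). x \<oplus> y)"
    and continuous_neg: "continuous_map T T (\<lambda>x. \<ominus> x)"

text \<open>Neighborhoods, here and below, need not be open.\<close>

definition neighborhood_in :: "'a topology \<Rightarrow> 'a \<Rightarrow> 'a set \<Rightarrow> bool" where
  "neighborhood_in T x N \<longleftrightarrow> N \<subseteq> topspace T \<and> (\<exists>V. openin T V \<and> x \<in> V \<and> V \<subseteq> N)"

definition local_base_at :: "'a topology \<Rightarrow> 'a \<Rightarrow> 'a set set \<Rightarrow> bool" where
  "local_base_at T x \<U> \<longleftrightarrow>
     (\<forall>U\<in>\<U>. neighborhood_in T x U) \<and>
     (\<forall>N. neighborhood_in T x N \<longrightarrow> (\<exists>U\<in>\<U>. U \<subseteq> N))"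

locale strongly_topological_gyrogroup = topological_gyrogroup +
  assumes gyr_invariant_base:
    "\<exists>\<U>. local_base_at T \<zero> \<U> \<and> (\<forall>U\<in>\<U>. \<forall>x\<in>G. \<forall>y\<in>G. gyr x y ` U = U)"

end

(* Call A well inside B if A \<oplus> U \<subseteq> B for some member U of the gyration-invariant base. Invariance gives
   (A \<oplus> V) \<oplus> V = A \<oplus> (V \<oplus> V), so the relation interpolates, and the dyadic construction from Urysohn's
   lemma yields continuous functions separating a point x from the complement of x \<oplus> U. The T1 axiom
   then comes from T0 and regularity. *)

theory Submission
  imports Defs
begin

section \<open>Urysohn's construction for an interpolating relation\<close>

lemma dyadic_between:
  fixes a b :: real
  assumes "0 \<le> a" "a < b"
  obtains r where "r \<in> dyadics" "a < r" "r < b"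
proof -
  \<comment> \<open>Two dyadics closer together than \<open>b - a\<close> straddle \<open>b\<close>.
    The lower one then exceeds \<open>a\<close>. Members of \<open>dyadics\<close> are nonnegative,
    which is why \<open>a\<close> is taken nonnegative.\<close>
  obtain n q r where "of_nat q / 2^n < b" "b < of_nat r / 2^n" "\<bar>of_nat q / 2^n - of_nat r / 2^n\<bar> < b - a"
    using padic_rational_approximation_straddle_pos[of "b - a" 2 b] assms by (smt (verit))
  then show thesis
    by (intro that[of "of_nat q / 2^n"]) (auto simp: dyadics_def)
qed

text \<open>Interpolation and transitivity index a chain of sets by the dyadics in [0,1], increasing
  for \<open>R\<close> from \<open>A\<close> to \<open>B\<close>. By \<open>sep\<close> the chain
  has the closure-in-interior property of Urysohn's lemma, so the infimum of the indices of the sets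
  containing a point is continuous.\<close>

lemma interpolating_relation_Urysohn:
  assumes "R A B"
    and interp: "\<And>C D. R C D \<Longrightarrow> \<exists>E. R C E \<and> R E D"
    and trans: "\<And>C D E. \<lbrakk>R C D; R D E\<rbrakk> \<Longrightarrow> R C E"
    and sep: "\<And>C D. R C D \<Longrightarrow> X closure_of C \<subseteq> X interior_of D"
  obtains f :: "'a \<Rightarrow> real"
  where "continuous_map X (top_of_set {0..1}) f" "f ` A \<subseteq> {0}" "f ` (topspace X - B) \<subseteq> {1}"
proof -
  define I where "I = dyadics \<inter> {0..1::real}"
  have "\<exists>L :: real \<Rightarrow> 'a set. L 0 = A \<and> L 1 = B \<and> (\<forall>r\<in>I. \<forall>s\<in>I. r < s \<longrightarrow> R (L r) (L s))"
    unfolding I_def using assms(1) interp trans by (rule recursion_on_dyadic_fractions)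
  then obtain L :: "real \<Rightarrow> 'a set" where L0: "L 0 = A" and L1: "L 1 = B"
    and LR: "\<And>r s. \<lbrakk>r \<in> I; s \<in> I; r < s\<rbrakk> \<Longrightarrow> R (L r) (L s)"
    by blast
  have L_sep: "X closure_of L r \<subseteq> X interior_of L s" if "r \<in> I" "s \<in> I" "r < s" for r s
    using LR sep that by blast
  \<comment> \<open>The sets \<open>L r\<close> may leave the space, and a closure is only sure to
    contain the part of a set inside it; hence the restriction to points of
    \<open>topspace X\<close>.\<close>
  have L_mono: "x \<in> L s" if "r \<in> I" "s \<in> I" "r \<le> s" "x \<in> L r" "x \<in> topspace X" for r s x
  proof (cases "r = s")
    case False
    then have "r < s" using that by simp
    moreover have "x \<in> X closure_of L r"
      using that by (auto simp: in_closure_of)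
    ultimately show ?thesis
      using L_sep that interior_of_subset by fast
  qed (use that in simp)
  \<comment> \<open>Inserting 1 keeps the set nonempty and gives the value 1 to points that lie in
    no \<open>L r\<close>.\<close>
  define f where "f x = Inf (insert 1 {r \<in> I. x \<in> L r})" for x
  have bdd: "bdd_below (insert 1 {r \<in> I. x \<in> L r})" for x
    unfolding I_def by (intro bdd_belowI[of _ 0]) auto
  have f_le: "f x \<le> r" if "r \<in> I" "x \<in> L r" for x r
    unfolding f_def using bdd that by (intro cInf_lower) auto
  have f_le1: "f x \<le> 1" for x
    unfolding f_def using bdd by (intro cInf_lower) auto
  have f_ge0: "0 \<le> f x" for x
    unfolding f_def I_def by (intro cInf_greatest) auto
  have f_ge: "r \<le> f x" if "r \<in> I" "x \<notin> L r" "x \<in> topspace X" for x r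
    unfolding f_def
  proof (rule cInf_greatest)
    fix s assume s: "s \<in> insert 1 {r \<in> I. x \<in> L r}"
    show "r \<le> s"
    proof (rule ccontr)
      assume "\<not> r \<le> s"
      then show False
        using s that L_mono[of s r x] by (auto simp: I_def)
    qed
  qed auto
  have between: "\<exists>r\<in>I. a < r \<and> r < b" if "0 \<le> a" "a < b" "b \<le> 1" for a b
    using dyadic_between[OF that(1,2)] that unfolding I_def by (metis Int_iff atLeastAtMost_iff less_le less_trans)
  have "openin X {x \<in> topspace X. f x < c}" for c
  proof (subst openin_subopen, intro ballI)
    fix x assume x: "x \<in> {x \<in> topspace X. f x < c}"
    show "\<exists>V. openin X V \<and> x \<in> V \<and> V \<subseteq> {x \<in> topspace X. f x < c}"
    proof (cases "c \<le> 1")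
      case True
      \<comment> \<open>Two indices are needed: \<open>f x < r\<close> puts \<open>x\<close> into
        \<open>L r\<close>, hence into the interior of \<open>L s\<close>, and on that open set
        \<open>f\<close> is at most \<open>s\<close>, thus below \<open>c\<close>.\<close>
      obtain r s where rs: "r \<in> I" "s \<in> I" "f x < r" "r < s" "s < c"
      proof -
        obtain s where s: "s \<in> I" "f x < s" "s < c"
          using between[of "f x" c] f_ge0 x True by auto
        moreover obtain r where "r \<in> I" "f x < r" "r < s"
          using between[of "f x" s] f_ge0 s True by auto
        ultimately show thesis using that by blast
      qed
      have "x \<in> L r"
        using f_ge[of r x] rs x by force
      then have "x \<in> X closure_of L r"
        using x by (auto simp: in_closure_of)
      then have "x \<in> X interior_of L s"
        using L_sep rs by blast
      moreover have "f y < c" if "y \<in> X interior_of L s" for y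
        using f_le[OF rs(2)] that interior_of_subset[of X "L s"] rs by fastforce
      ultimately show ?thesis
        by (intro exI[of _ "X interior_of L s"]) (use interior_of_subset_topspace in fastforce)
    next
      case False
      then have "f y < c" for y
        using f_le1[of y] by linarith
      then show ?thesis
        using x by (intro exI[of _ "topspace X"]) auto
    qed
  qed
  moreover have "openin X {x \<in> topspace X. c < f x}" for c
  proof (subst openin_subopen, intro ballI)
    fix x assume x: "x \<in> {x \<in> topspace X. c < f x}"
    show "\<exists>V. openin X V \<and> x \<in> V \<and> V \<subseteq> {x \<in> topspace X. c < f x}"
    proof (cases "0 \<le> c")
      case True
      \<comment> \<open>Dually, \<open>s < f x\<close> keeps \<open>x\<close> out of
        \<open>L s\<close>, hence out of the closure of \<open>L r\<close>; on the open complement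
        of that closure \<open>f\<close> is at least \<open>r\<close>, thus above
        \<open>c\<close>.\<close>
      obtain r s where rs: "r \<in> I" "s \<in> I" "c < r" "r < s" "s < f x"
      proof -
        obtain r where r: "r \<in> I" "c < r" "r < f x"
          using between[of c "f x"] f_le1 x True by auto
        moreover obtain s where "s \<in> I" "r < s" "s < f x"
          using between[of r "f x"] f_le1 r True by auto
        ultimately show thesis using that by blast
      qed
      have "x \<notin> L s"
        using f_le[of s x] rs by force
      then have "x \<notin> X closure_of L r"
        using L_sep rs interior_of_subset by fast
      moreover have "c < f y" if "y \<in> topspace X - X closure_of L r" for y
      proof -
        have "y \<notin> L r"
          using that by (auto simp: in_closure_of)
        then show ?thesis
          using f_ge[OF rs(1)] that rs by fastforce
      qed
      ultimately show ?thesis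
        using x by (intro exI[of _ "topspace X - X closure_of L r"]) auto
    next
      case False
      then have "c < f y" for y
        using f_ge0[of y] by linarith
      then show ?thesis
        using x by (intro exI[of _ "topspace X"]) auto
    qed
  qed
  ultimately have "continuous_map X euclideanreal f"
    by (simp add: continuous_map_upper_lower_semicontinuous_lt)
  then have "continuous_map X (top_of_set {0..1}) f"
    using f_ge0 f_le1 by (auto simp: continuous_map_in_subtopology)
  moreover have "f ` A \<subseteq> {0}"
  proof -
    have "f x = 0" if "x \<in> A" for x
      using f_le[of 0 x] f_ge0[of x] that L0 by (auto simp: I_def dyadics_def)
    then show ?thesis by auto
  qed
  moreover have "f ` (topspace X - B) \<subseteq> {1}"
  proof -
    have "(1::real) \<in> I"
      using real_in_dyadics[of 1] by (simp add: I_def)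
    then have "f x = 1" if "x \<in> topspace X - B" for x
      using f_ge[of 1 x] f_le1[of x] that L1 by auto
    then show ?thesis by auto
  qed
  ultimately show thesis
    by (rule that)
qed

section \<open>Cancellation laws in gyrogroups\<close>

context gyrogroup
begin

lemma gyr_closed: "\<lbrakk>x \<in> G; y \<in> G; z \<in> G\<rbrakk> \<Longrightarrow> gyr x y z \<in> G"
  using gyr_bij bij_betwE by fast

text \<open>Adding \<open>x\<close> and then its inverse on the left amounts to applying one
  gyration, and gyrations are injective. That this gyration is the identity is only shown later,
  with the help of this law.\<close>

lemma add_left_imp_eq:
  assumes "x \<in> G" "y \<in> G" "z \<in> G" "x \<oplus> y = x \<oplus> z"
  shows "y = z"
proof -
  have "gyr (\<ominus> x) x u = \<ominus> x \<oplus> (x \<oplus> u)" if "u \<in> G" for u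
    using assms that gyr_assoc[of "\<ominus> x" x u] by (simp add: neg_closed neg_add zero_add gyr_closed)
  then have "gyr (\<ominus> x) x y = gyr (\<ominus> x) x z"
    using assms by simp
  then show ?thesis
    using gyr_bij[of "\<ominus> x" x] assms by (auto simp: neg_closed bij_betw_def inj_on_def)
qed

lemma gyr_zero_left: "\<lbrakk>y \<in> G; z \<in> G\<rbrakk> \<Longrightarrow> gyr \<zero> y z = z"
  using gyr_assoc[of \<zero> y z] add_left_imp_eq[of y z "gyr \<zero> y z"]
  by (simp add: zero_closed zero_add add_closed gyr_closed)

text \<open>The loop property replaces the first argument of the gyration by
  \<open>\<ominus> x \<oplus> x\<close>, which is zero, and a gyration with first argument zero is
  the identity.\<close>

lemma neg_add_cancel:
  assumes "x \<in> G" "y \<in> G"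
  shows "\<ominus> x \<oplus> (x \<oplus> y) = y"
proof -
  have "gyr (\<ominus> x) x y = y"
    using gyr_loop[of "\<ominus> x" x y] assms by (simp add: neg_closed neg_add gyr_zero_left)
  then show ?thesis
    using gyr_assoc[of "\<ominus> x" x y] assms by (simp add: neg_closed neg_add zero_add)
qed

text \<open>Undoing an addition on the right costs a gyration of the inverse; an invariant
  neighborhood absorbs it.\<close>

lemma add_neg_cancel:
  assumes "x \<in> G" "y \<in> G"
  shows "(x \<oplus> y) \<oplus> gyr x y (\<ominus> y) = x"
  using gyr_assoc[of x y "\<ominus> y"] assms by (simp add: neg_closed add_neg add_zero)

lemma neg_neg: "x \<in> G \<Longrightarrow> \<ominus> (\<ominus> x) = x"
  using neg_unique[of "\<ominus> x" x] by (simp add: neg_closed neg_add add_neg)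

lemma add_neg_add_cancel: "\<lbrakk>x \<in> G; y \<in> G\<rbrakk> \<Longrightarrow> x \<oplus> (\<ominus> x \<oplus> y) = y"
  using neg_add_cancel[of "\<ominus> x" y] by (simp add: neg_closed neg_neg)

end

section \<open>Translating and halving neighborhoods\<close>

context topological_gyrogroup
begin

lemma continuous_map_add_left:
  assumes "a \<in> G"
  shows "continuous_map T T (\<lambda>x. a \<oplus> x)"
proof -
  have "continuous_map T (prod_topology T T) (\<lambda>x. (a, x))"
    using assms by (simp add: continuous_map_pairedI topspace_eq)
  from continuous_map_compose[OF this continuous_add] show ?thesis
    by (simp add: o_def)
qed

text \<open>Left translation by \<open>x\<close> is inverted by left translation by
  \<open>\<ominus> x\<close>, so the translate of an open set is a preimage under a continuous
  map.\<close>

lemma neighborhood_in_translate: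
  assumes "x \<in> G" "neighborhood_in T \<zero> U"
  shows "neighborhood_in T x ((\<oplus>) x ` U)"
proof -
  obtain V where V: "openin T V" "\<zero> \<in> V" "V \<subseteq> U" and U: "U \<subseteq> G"
    using assms by (auto simp: neighborhood_in_def topspace_eq)
  define W where "W = {y \<in> topspace T. \<ominus> x \<oplus> y \<in> V}"
  have "openin T W"
    unfolding W_def using assms V
    by (intro openin_continuous_map_preimage[OF continuous_map_add_left]) (auto simp: neg_closed)
  moreover have "x \<in> W"
    using assms V by (simp add: W_def topspace_eq neg_add)
  moreover have "W \<subseteq> (\<oplus>) x ` U"
  proof
    fix y assume "y \<in> W"
    then have "y = x \<oplus> (\<ominus> x \<oplus> y)" "\<ominus> x \<oplus> y \<in> U"
      using assms V by (auto simp: W_def topspace_eq add_neg_add_cancel)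
    then show "y \<in> (\<oplus>) x ` U" by blast
  qed
  ultimately show ?thesis
    using assms U by (auto simp: neighborhood_in_def topspace_eq intro: add_closed)
qed

lemma neighborhood_in_halve:
  assumes "neighborhood_in T \<zero> U"
  obtains V where "neighborhood_in T \<zero> V" "\<And>v w. \<lbrakk>v \<in> V; w \<in> V\<rbrakk> \<Longrightarrow> v \<oplus> w \<in> U"
proof -
  obtain W where W: "openin T W" "\<zero> \<in> W" "W \<subseteq> U"
    using assms by (auto simp: neighborhood_in_def)
  have "openin (prod_topology T T) {p \<in> topspace (prod_topology T T). (\<lambda>(x, y). x \<oplus> y) p \<in> W}"
    using openin_continuous_map_preimage[OF continuous_add W(1)] .
  moreover have "(\<zero>, \<zero>) \<in> {p \<in> topspace (prod_topology T T). (\<lambda>(x, y). x \<oplus> y) p \<in> W}"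
    using W by (simp add: topspace_eq zero_closed zero_add)
  ultimately obtain P Q where PQ: "openin T P" "openin T Q" "\<zero> \<in> P" "\<zero> \<in> Q"
    "P \<times> Q \<subseteq> {p \<in> topspace (prod_topology T T). (\<lambda>(x, y). x \<oplus> y) p \<in> W}"
    unfolding openin_prod_topology_alt by meson
  show thesis
  proof
    have "openin T (P \<inter> Q)" using PQ by blast
    then show "neighborhood_in T \<zero> (P \<inter> Q)"
      using PQ openin_subset unfolding neighborhood_in_def by blast
    show "v \<oplus> w \<in> U" if "v \<in> P \<inter> Q" "w \<in> P \<inter> Q" for v w
      using PQ W that by auto
  qed
qed

end

section \<open>The relation of being well inside, for a gyration-invariant base\<close>

definition (in gyrogroup) well_inside :: "'a set set \<Rightarrow> 'a set \<Rightarrow> 'a set \<Rightarrow> bool" where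
  "well_inside \<U> A B \<longleftrightarrow> A \<subseteq> G \<and> B \<subseteq> G \<and> (\<exists>U\<in>\<U>. \<forall>a\<in>A. \<forall>u\<in>U. a \<oplus> u \<in> B)"

context topological_gyrogroup
begin

context
  fixes \<U> :: "'a set set"
  assumes base: "local_base_at T \<zero> \<U>"
    and invariant: "\<And>U x y. \<lbrakk>U \<in> \<U>; x \<in> G; y \<in> G\<rbrakk> \<Longrightarrow> gyr x y ` U = U"
begin

lemma base_neighborhood: "U \<in> \<U> \<Longrightarrow> neighborhood_in T \<zero> U"
  using base by (simp add: local_base_at_def)

lemma base_subset: "U \<in> \<U> \<Longrightarrow> U \<subseteq> G"
  using base_neighborhood by (auto simp: neighborhood_in_def topspace_eq)

lemma base_zero: "U \<in> \<U> \<Longrightarrow> \<zero> \<in> U"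
  using base_neighborhood by (auto simp: neighborhood_in_def)

lemma base_refine:
  assumes "neighborhood_in T \<zero> N"
  obtains U where "U \<in> \<U>" "U \<subseteq> N"
  using base assms by (auto simp: local_base_at_def)

lemma well_inside_subset: "well_inside \<U> A B \<Longrightarrow> A \<subseteq> B"
  unfolding well_inside_def using base_zero add_zero by fastforce

text \<open>Since \<open>A\<close> lies in \<open>B\<close>, the base member witnessing the second
  relation also serves for the conclusion.\<close>

lemma well_inside_trans: "\<lbrakk>well_inside \<U> A B; well_inside \<U> B C\<rbrakk> \<Longrightarrow> well_inside \<U> A C"
  using well_inside_subset[of A B] unfolding well_inside_def by (meson subsetD)

lemma well_inside_interpolate:
  assumes "well_inside \<U> A B"
  shows "\<exists>C. well_inside \<U> A C \<and> well_inside \<U> C B"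
proof -
  obtain U where U: "U \<in> \<U>" "\<And>a u. \<lbrakk>a \<in> A; u \<in> U\<rbrakk> \<Longrightarrow> a \<oplus> u \<in> B" and AB: "A \<subseteq> G" "B \<subseteq> G"
    using assms by (auto simp: well_inside_def)
  obtain N where N: "neighborhood_in T \<zero> N" "\<And>v w. \<lbrakk>v \<in> N; w \<in> N\<rbrakk> \<Longrightarrow> v \<oplus> w \<in> U"
    using neighborhood_in_halve[OF base_neighborhood[OF U(1)]] by blast
  obtain V where V: "V \<in> \<U>" "V \<subseteq> N"
    using base_refine[OF N(1)] .
  \<comment> \<open>The interpolant is \<open>A \<oplus> V\<close>, where sums of two elements of
    \<open>V\<close> lie in \<open>U\<close>.\<close>
  define C where "C = {a \<oplus> v | a v. a \<in> A \<and> v \<in> V}"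
  have C: "C \<subseteq> G"
    using AB base_subset[OF V(1)] by (auto simp: C_def intro: add_closed)
  have "(a \<oplus> v) \<oplus> w \<in> B" if "a \<in> A" "v \<in> V" "w \<in> V" for a v w
  proof -
    have G: "a \<in> G" "v \<in> G"
      using that AB base_subset[OF V(1)] by auto
    \<comment> \<open>Here invariance is used as surjectivity onto \<open>V\<close>:
      \<open>w\<close> becomes the gyration that regrouping to the right removes.\<close>
    have "w \<in> gyr a v ` V"
      using invariant[OF V(1) G] that(3) by simp
    then obtain w' where w': "w' \<in> V" "w = gyr a v w'"
      by (elim imageE)
    then have "(a \<oplus> v) \<oplus> w = a \<oplus> (v \<oplus> w')"
      using gyr_assoc G base_subset[OF V(1)] by auto
    moreover have "v \<oplus> w' \<in> U"
      using N(2) V(2) that(2) w'(1) by blast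
    ultimately show ?thesis
      using U(2) that(1) by simp
  qed
  then have "well_inside \<U> C B"
    unfolding well_inside_def using V C AB by (auto simp: C_def)
  moreover have "well_inside \<U> A C"
    unfolding well_inside_def using V C AB by (auto simp: C_def)
  ultimately show ?thesis by blast
qed

lemma subset_interior_if_well_inside:
  assumes "well_inside \<U> A B"
  shows "A \<subseteq> T interior_of B"
proof
  fix a assume a: "a \<in> A"
  obtain U where U: "U \<in> \<U>" "(\<oplus>) a ` U \<subseteq> B" and "A \<subseteq> G"
    using assms a unfolding well_inside_def by blast
  then have "neighborhood_in T a ((\<oplus>) a ` U)"
    using neighborhood_in_translate[OF _ base_neighborhood[OF U(1)]] a by auto
  then obtain V where "openin T V" "a \<in> V" "V \<subseteq> (\<oplus>) a ` U"
    unfolding neighborhood_in_def by (elim conjE exE)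
  then show "a \<in> T interior_of B"
    using U(2) interior_of_maximal[of V B T] by (meson order_trans subsetD)
qed

text \<open>If \<open>x\<close> is in the closure, some \<open>x \<oplus> w\<close> lies in
  \<open>A\<close> with \<open>\<ominus> w\<close> in \<open>U\<close>. Right cancellation recovers
  \<open>x\<close> from \<open>x \<oplus> w\<close> by adding a gyration of
  \<open>\<ominus> w\<close>, which stays in \<open>U\<close> by invariance.\<close>

lemma closure_subset_if_well_inside:
  assumes "well_inside \<U> A B"
  shows "T closure_of A \<subseteq> B"
proof
  fix x assume x: "x \<in> T closure_of A"
  then have xG: "x \<in> G" by (simp add: in_closure_of topspace_eq)
  obtain U where U: "U \<in> \<U>" "\<And>a u. \<lbrakk>a \<in> A; u \<in> U\<rbrakk> \<Longrightarrow> a \<oplus> u \<in> B"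
    using assms by (auto simp: well_inside_def)
  obtain V where V: "openin T V" "\<zero> \<in> V" "V \<subseteq> U"
    using base_neighborhood[OF U(1)] by (auto simp: neighborhood_in_def)
  define W where "W = {y \<in> topspace T. \<ominus> y \<in> V}"
  have "\<ominus> \<zero> = \<zero>"
    using neg_unique[of \<zero> \<zero>] by (simp add: zero_closed zero_add)
  moreover have "openin T W"
    unfolding W_def by (rule openin_continuous_map_preimage[OF continuous_neg V(1)])
  ultimately have "neighborhood_in T \<zero> W"
    using V zero_closed openin_subset by (auto simp: neighborhood_in_def W_def topspace_eq)
  from neighborhood_in_translate[OF xG this]
  obtain N where N: "openin T N" "x \<in> N" "N \<subseteq> (\<oplus>) x ` W"
    by (auto simp: neighborhood_in_def)
  then obtain y where "y \<in> A" "y \<in> N"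
    using x by (auto simp: in_closure_of)
  then obtain w where w: "w \<in> W" "x \<oplus> w \<in> A"
    using N by blast
  have wG: "w \<in> G"
    using w by (simp add: W_def topspace_eq)
  have "gyr x w (\<ominus> w) \<in> U"
    using invariant[OF U(1) xG wG] w V by (auto simp: W_def)
  then show "x \<in> B"
    using U(2)[OF w(2)] add_neg_cancel[OF xG wG] by metis
qed

text \<open>An interpolant contains the closure of \<open>A\<close> and lies in the interior of
  \<open>B\<close>.\<close>

lemma closure_subset_interior_if_well_inside:
  assumes "well_inside \<U> A B"
  shows "T closure_of A \<subseteq> T interior_of B"
proof -
  obtain C where "well_inside \<U> A C" "well_inside \<U> C B"
    using well_inside_interpolate[OF assms] by (elim exE conjE)
  then show ?thesis
    using closure_subset_if_well_inside subset_interior_if_well_inside order_trans by metis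
qed

text \<open>This is continuity at zero of left translation by \<open>x\<close>; it starts the chain
  for a point and the complement of a closed set.\<close>

lemma well_inside_open:
  assumes "openin T B" "x \<in> B"
  shows "well_inside \<U> {x} B"
proof -
  have B: "B \<subseteq> G" and x: "x \<in> G"
    using assms openin_subset topspace_eq by auto
  have "openin T {y \<in> topspace T. x \<oplus> y \<in> B}"
    by (rule openin_continuous_map_preimage[OF continuous_map_add_left[OF x] assms(1)])
  then have "neighborhood_in T \<zero> {y \<in> topspace T. x \<oplus> y \<in> B}"
    using assms x by (auto simp: neighborhood_in_def topspace_eq zero_closed add_zero)
  then obtain U where "U \<in> \<U>" "U \<subseteq> {y \<in> topspace T. x \<oplus> y \<in> B}"
    by (rule base_refine)
  then show ?thesis
    using B x by (auto simp: well_inside_def)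
qed

lemma completely_regular_space_if_invariant_base: "completely_regular_space T"
  unfolding completely_regular_space_def
proof (intro allI impI)
  fix S x assume S: "closedin T S \<and> x \<in> topspace T - S"
  then have "well_inside \<U> {x} (topspace T - S)"
    by (intro well_inside_open) auto
  then obtain f :: "'a \<Rightarrow> real" where "continuous_map T (top_of_set {0..1}) f" "f ` {x} \<subseteq> {0}"
    "f ` (topspace T - (topspace T - S)) \<subseteq> {1}"
    using well_inside_interpolate well_inside_trans closure_subset_interior_if_well_inside
    by (rule interpolating_relation_Urysohn)
  moreover have "topspace T - (topspace T - S) = S"
    using S closedin_subset by fastforce
  ultimately show "\<exists>f::'a \<Rightarrow> real. continuous_map T (top_of_set {0..1}) f \<and> f x = 0 \<and> f ` S \<subseteq> {1}"
    by auto
qed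

end

end

section \<open>Complete regularity together with T1\<close>

theorem theorem3p5:
  fixes G :: "'a set"
    and add :: "'a \<Rightarrow> 'a \<Rightarrow> 'a"
    and gzero :: 'a
    and neg :: "'a \<Rightarrow> 'a"
    and gyr :: "'a \<Rightarrow> 'a \<Rightarrow> 'a \<Rightarrow> 'a"
    and T :: "'a topology"
  assumes "strongly_topological_gyrogroup G add gzero neg gyr T"
    and "t0_space T"
  shows "t1_space T \<and> completely_regular_space T"
proof -
  interpret strongly_topological_gyrogroup G add gzero neg gyr T
    by fact
  obtain \<U> where "local_base_at T gzero \<U>" "\<forall>U\<in>\<U>. \<forall>x\<in>G. \<forall>y\<in>G. gyr x y ` U = U"
    using gyr_invariant_base by (elim exE conjE)
  then have cr: "completely_regular_space T"
    using completely_regular_space_if_invariant_base[of \<U>] by simp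
  \<comment> \<open>\<open>completely_regular_space\<close> contains no T1 condition. Complete
    regularity gives regularity, which lifts T0 to Hausdorff.\<close>
  then have "Hausdorff_space T"
    using assms(2) by (intro regular_t0_imp_Hausdorff_space completely_regular_imp_regular_space)
  then show ?thesis
    using cr by (simp add: Hausdorff_imp_t1_space)
qed

end
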